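(* Let $\mathbb{F}$ be a countable field and let $\mathbf{V}$ be a variety of $\mathbb{F}$-algebras with quasi-inversion containing $R_{\mathbb{F}}$ as an element. Then there exists no $\mathbb{L}(\mathcal{R}_{\mathbf{V}}(\omega_1))$-valued Banaschewski measure on the subset $\{\tilde{\xi}\cdot\mathcal{R}_{\mathbf{V}}(\omega_1)\mid\xi<\omega_1\}$ of $\mathbb{L}(\mathcal{R}_{\mathbf{V}}(\omega_1))$.
   Context: "Countable" means at most countable. For a field $\mathbb{F}$, $\Sigma_{\mathbb{F}}$ is the similarity type with constants $0,1$, binary operations $-$ and $\cdot$, a unary operation $'$, and unary operations $h_\lambda$ ($\lambda\in\mathbb{F}$, multiplication by $\lambda$). $\mathbf{Reg}_{\mathbb{F}}$ is the variety of all unital $\mathbb{F}$-algebras endowed with a unary operation $x\mapsto x'$ satisfying the identity $xx'x=x$; its members are called $\mathbb{F}$-algebras with quasi-inversion. A variety of $\mathbb{F}$-algebras with quasi-inversion is a class of $\Sigma_{\mathbb{F}}$-structures defined by a set of identities and contained in $\mathbf{Reg}_{\mathbb{F}}$. For such a variety $\mathbf{V}$ and a chain $\Lambda$, $\mathcal{R}_{\mathbf{V}}(\Lambda)$ is the $\mathbf{V}$-object defined by generators $\tilde{\alpha}$ ($\alpha\in\Lambda$) and relations $\tilde{\alpha}=\tilde{\beta}\cdot\tilde{\alpha}$ for all $\alpha\le\beta$ in $\Lambda$. Here $\omega_1$ is the first uncountable ordinal, viewed as a chain. Definition of $R_{\mathbb{F}}$: in $\mathbb{F}^{3\times3}$ let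 $A=\begin{pmatrix}1&0&0\\0&0&0\\0&0&0\end{pmatrix}$, $B=\begin{pmatrix}1&0&1\\0&1&0\\0&0&0\end{pmatrix}$, $I$ the identity matrix; let $\mathbb{F}[M]$ be the unital $\mathbb{F}$-subalgebra generated by $M$. One has $\mathbb{F}[A]\cap\mathbb{F}[B]=\mathbb{F}\cdot I$. For each $X\in\mathbb{F}^{3\times3}$ fix a quasi-inverse $X'$ of $X$ (i.e. $XX'X=X$) lying in the smallest member of $\{\mathbb{F}\cdot I,\mathbb{F}[A],\mathbb{F}[B],\mathbb{F}^{3\times3}\}$ containing $X$. $R_{\mathbb{F}}$ is $\mathbb{F}^{3\times3}$ endowed with this (fixed) quasi-inversion. For a regular ring $R$, $\mathbb{L}(R):=\{xR\mid x\in R\}$, ordered by inclusion, is the (sectionally complemented modular) lattice of principal right ideals. For a subset $X$ of a lattice $L$ with zero, put $X^{[2]}:=\{(x,y)\in X\times X\mid x\le y\}$. An $L$-valued Banaschewski measure on $X$ is a map $\ominus\colon X^{[2]}\to L$, $(x,y)\mapsto y\ominus x$, isotone in $y$ and antitone in $x$, such that $y=x\oplus(y\ominus x)$ (i.e. $x\wedge(y\ominus x)=0$ and $x\vee(y\ominus x)=y$) for all $x\le y$ in $X$. *)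

theory Defs
  imports
    "HOL-Analysis.Cartesian_Space"
    "HOL-Library.Countable_Set_Type"
    "HOL-Algebra.Ring"
    "HOL-Algebra.Lattice"
begin

section \<open>The similarity type of algebras with quasi-inversion\<close>

text \<open>Multiplication and the constant 1 come from \<open>monoid\<close>.  Addition is not a basic operation.\<close>

record ('a, 'f) sig_struct = "'a monoid" +
  null :: 'a
  diff :: "'a \<Rightarrow> 'a \<Rightarrow> 'a"
  qinv :: "'a \<Rightarrow> 'a"
  scal :: "'f \<Rightarrow> 'a \<Rightarrow> 'a"

definition sig_closed :: "('a, 'f) sig_struct \<Rightarrow> bool" where
  "sig_closed S \<longleftrightarrow>
     null S \<in> carrier S \<and> one S \<in> carrier S \<and>
     (\<forall>x\<in>carrier S. \<forall>y\<in>carrier S. diff S x y \<in> carrier S \<and> mult S x y \<in> carrier S) \<and>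
     (\<forall>x\<in>carrier S. qinv S x \<in> carrier S \<and> (\<forall>c. scal S c x \<in> carrier S))"

datatype ('f, 'v) trm =
    Var 'v
  | Zero
  | One
  | Diff "('f, 'v) trm" "('f, 'v) trm"
  | Mult "('f, 'v) trm" "('f, 'v) trm"
  | QInv "('f, 'v) trm"
  | Scal 'f "('f, 'v) trm"

primrec eval :: "('a, 'f) sig_struct \<Rightarrow> ('v \<Rightarrow> 'a) \<Rightarrow> ('f, 'v) trm \<Rightarrow> 'a" where
  "eval S \<rho> (Var v) = \<rho> v"
| "eval S \<rho> Zero = null S"
| "eval S \<rho> One = one S"
| "eval S \<rho> (Diff s t) = diff S (eval S \<rho> s) (eval S \<rho> t)"
| "eval S \<rho> (Mult s t) = mult S (eval S \<rho> s) (eval S \<rho> t)"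
| "eval S \<rho> (QInv t) = qinv S (eval S \<rho> t)"
| "eval S \<rho> (Scal c t) = scal S c (eval S \<rho> t)"

type_synonym 'f identity = "('f, nat) trm \<times> ('f, nat) trm"

definition satisfies :: "('a, 'f) sig_struct \<Rightarrow> 'f identity set \<Rightarrow> bool" where
  "satisfies S E \<longleftrightarrow> sig_closed S \<and>
     (\<forall>(s, t)\<in>E. \<forall>\<rho>. range \<rho> \<subseteq> carrier S \<longrightarrow> eval S \<rho> s = eval S \<rho> t)"


section \<open>Algebras with quasi-inversion and their varieties\<close>

definition ring_of :: "('a, 'f) sig_struct \<Rightarrow> 'a ring" where
  "ring_of S = \<lparr>carrier = carrier S, monoid.mult = mult S, one = one S,
                zero = null S, add = (\<lambda>x y. diff S x (diff S (null S) y))\<rparr>"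

definition in_Reg :: "('a, 'f::field) sig_struct \<Rightarrow> bool" where
  "in_Reg S \<longleftrightarrow> sig_closed S \<and> ring (ring_of S) \<and>
     (\<forall>x\<in>carrier S. \<forall>y\<in>carrier S. diff S x y = x \<ominus>\<^bsub>ring_of S\<^esub> y) \<and>
     (\<forall>c. \<forall>x\<in>carrier S. \<forall>y\<in>carrier S.
        scal S c (x \<oplus>\<^bsub>ring_of S\<^esub> y) = scal S c x \<oplus>\<^bsub>ring_of S\<^esub> scal S c y \<and>
        scal S c (mult S x y) = mult S (scal S c x) y \<and>
        scal S c (mult S x y) = mult S x (scal S c y)) \<and>
     (\<forall>c d. \<forall>x\<in>carrier S.
        scal S (c + d) x = scal S c x \<oplus>\<^bsub>ring_of S\<^esub> scal S d x \<and>
        scal S (c * d) x = scal S c (scal S d x)) \<and>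
     (\<forall>x\<in>carrier S. scal S 1 x = x \<and> mult S (mult S x (qinv S x)) x = x)"

text \<open>
  A variety is represented by a set \<open>E\<close> of identities defining it; a structure \<open>S\<close> (over any type)
  belongs to it iff \<open>satisfies S E\<close>.  HOL cannot quantify over all types in a formula, so containment
  of the variety in \<open>Reg\<close> is required for the structures over the one type that contains the free
  algebra on countably many generators; lemma \<open>qi_variety_in_Reg\<close> below shows that containment for
  structures over every other type follows.
\<close>

definition qi_variety :: "'f::field identity set \<Rightarrow> bool" where
  "qi_variety E \<longleftrightarrow>
     (\<forall>S :: (('f, nat) trm set, 'f) sig_struct. satisfies S E \<longrightarrow> in_Reg S)"


section \<open>Objects defined by generators and relations\<close>

definition term_struct :: "(('f, 'v) trm, 'f) sig_struct" where
  "term_struct = \<lparr>carrier = UNIV, monoid.mult = Mult, one = One,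
                  null = Zero, diff = Diff, qinv = QInv, scal = Scal\<rparr>"

text \<open>
  The least congruence of the term algebra that contains the relations \<open>Q\<close> and all substitution
  instances of the identities \<open>E\<close>; evaluation in \<open>term_struct\<close> is substitution.
\<close>

inductive pres_eq :: "'f identity set \<Rightarrow> ('f, 'v) trm rel \<Rightarrow> ('f, 'v) trm \<Rightarrow> ('f, 'v) trm \<Rightarrow> bool"
  for E :: "'f identity set" and Q :: "('f, 'v) trm rel" where
  rel: "(s, t) \<in> Q \<Longrightarrow> pres_eq E Q s t"
| inst: "(s, t) \<in> E \<Longrightarrow> pres_eq E Q (eval term_struct \<sigma> s) (eval term_struct \<sigma> t)"
| refl: "pres_eq E Q t t"
| sym: "pres_eq E Q s t \<Longrightarrow> pres_eq E Q t s"
| trans: "pres_eq E Q s t \<Longrightarrow> pres_eq E Q t u \<Longrightarrow> pres_eq E Q s u"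
| Diff: "pres_eq E Q s s' \<Longrightarrow> pres_eq E Q t t' \<Longrightarrow> pres_eq E Q (Diff s t) (Diff s' t')"
| Mult: "pres_eq E Q s s' \<Longrightarrow> pres_eq E Q t t' \<Longrightarrow> pres_eq E Q (Mult s t) (Mult s' t')"
| QInv: "pres_eq E Q t t' \<Longrightarrow> pres_eq E Q (QInv t) (QInv t')"
| Scal: "pres_eq E Q t t' \<Longrightarrow> pres_eq E Q (Scal c t) (Scal c t')"

definition pres_class :: "'f identity set \<Rightarrow> ('f, 'v) trm rel \<Rightarrow> ('f, 'v) trm \<Rightarrow> ('f, 'v) trm set" where
  "pres_class E Q t = {u. pres_eq E Q t u}"

definition presented :: "'f identity set \<Rightarrow> ('f, 'v) trm rel \<Rightarrow> (('f, 'v) trm set, 'f) sig_struct" where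
  "presented E Q =
     \<lparr>carrier = range (pres_class E Q),
      monoid.mult = (\<lambda>X Y. \<Union>s\<in>X. \<Union>t\<in>Y. pres_class E Q (Mult s t)),
      one = pres_class E Q One,
      null = pres_class E Q Zero,
      diff = (\<lambda>X Y. \<Union>s\<in>X. \<Union>t\<in>Y. pres_class E Q (Diff s t)),
      qinv = (\<lambda>X. \<Union>t\<in>X. pres_class E Q (QInv t)),
      scal = (\<lambda>c X. \<Union>t\<in>X. pres_class E Q (Scal c t))\<rparr>"

definition chain_rels :: "('f, 'v::linorder) trm rel" where
  "chain_rels = {(Var \<alpha>, Mult (Var \<beta>) (Var \<alpha>)) | \<alpha> \<beta>. \<alpha> \<le> \<beta>}"

definition chain_alg :: "'f identity set \<Rightarrow> (('f, 'v::linorder) trm set, 'f) sig_struct" where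
  "chain_alg E = presented E chain_rels"

definition chain_gen :: "'f identity set \<Rightarrow> 'v::linorder \<Rightarrow> ('f, 'v) trm set" where
  "chain_gen E \<xi> = pres_class E chain_rels (Var \<xi>)"

lemma pres_class_eq_iff: "pres_class E Q s = pres_class E Q t \<longleftrightarrow> pres_eq E Q s t"
proof
  assume "pres_class E Q s = pres_class E Q t"
  moreover have "t \<in> pres_class E Q t"
    by (simp add: pres_class_def pres_eq.refl)
  ultimately show "pres_eq E Q s t"
    by (simp add: pres_class_def set_eq_iff)
next
  assume "pres_eq E Q s t"
  then have "pres_eq E Q s u \<longleftrightarrow> pres_eq E Q t u" for u
    by (meson pres_eq.sym pres_eq.trans)
  then show "pres_class E Q s = pres_class E Q t"
    by (simp add: pres_class_def)
qed

lemma UN_pres_class: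
  assumes "\<And>u. pres_eq E Q t u \<Longrightarrow> f u = X"
  shows "(\<Union>u\<in>pres_class E Q t. f u) = X"
proof -
  have "t \<in> pres_class E Q t"
    by (simp add: pres_class_def pres_eq.refl)
  then show ?thesis
    using assms by (fastforce simp: pres_class_def)
qed

lemma presented_ops:
  shows "mult (presented E Q) (pres_class E Q s) (pres_class E Q t) = pres_class E Q (Mult s t)"
    and "diff (presented E Q) (pres_class E Q s) (pres_class E Q t) = pres_class E Q (Diff s t)"
    and "qinv (presented E Q) (pres_class E Q t) = pres_class E Q (QInv t)"
    and "scal (presented E Q) c (pres_class E Q t) = pres_class E Q (Scal c t)"
    and "one (presented E Q) = pres_class E Q One"
    and "null (presented E Q) = pres_class E Q Zero"
    and "carrier (presented E Q) = range (pres_class E Q)"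
  unfolding presented_def partial_object.simps monoid.simps sig_struct.simps
  by (intro UN_pres_class pres_class_eq_iff[THEN iffD2] HOL.refl,
      ((rule pres_eq.Diff pres_eq.Mult pres_eq.QInv pres_eq.Scal; rule pres_eq.sym; assumption)+)?)+

lemma sig_closed_presented: "sig_closed (presented E Q)"
  by (auto simp: sig_closed_def presented_ops)

lemma eval_presented:
  "eval (presented E Q) (\<lambda>v. pres_class E Q (\<sigma> v)) t = pres_class E Q (eval term_struct \<sigma> t)"
  by (induction t) (auto simp: presented_ops term_struct_def)

lemma satisfies_presented: "satisfies (presented E Q) E"
proof -
  have "eval (presented E Q) \<rho> s = eval (presented E Q) \<rho> t"
    if "(s, t) \<in> E" "range \<rho> \<subseteq> carrier (presented E Q)" for s t \<rho>
  proof -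
    have "\<forall>v. \<exists>u. \<rho> v = pres_class E Q u"
      using that(2) by (auto simp: presented_ops)
    then obtain \<sigma> where "\<rho> = (\<lambda>v. pres_class E Q (\<sigma> v))"
      by metis
    then show ?thesis
      using that(1) by (simp add: eval_presented pres_class_eq_iff pres_eq.inst)
  qed
  then show ?thesis
    by (auto simp: satisfies_def sig_closed_presented)
qed

lemma eval_closed:
  "sig_closed S \<Longrightarrow> range \<rho> \<subseteq> carrier S \<Longrightarrow> eval S \<rho> t \<in> carrier S"
  by (induction t) (auto simp: sig_closed_def)

lemma eval_subst: "eval S \<rho> (eval term_struct \<sigma> t) = eval S (\<lambda>v. eval S \<rho> (\<sigma> v)) t"
  by (induction t) (auto simp: term_struct_def)

text \<open>
  Together with \<open>satisfies_presented\<close>, the next lemma gives the universal property of \<open>presented\<close>: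
  an assignment in a member of the variety that respects the relations factors through the quotient.
\<close>

lemma pres_eq_sound:
  assumes "satisfies S E" and "range \<rho> \<subseteq> carrier S"
    and "\<And>s t. (s, t) \<in> Q \<Longrightarrow> eval S \<rho> s = eval S \<rho> t"
    and "pres_eq E Q s t"
  shows "eval S \<rho> s = eval S \<rho> t"
  using assms(4)
proof induction
  case (inst s t \<sigma>)
  have "range (\<lambda>v. eval S \<rho> (\<sigma> v)) \<subseteq> carrier S"
    using eval_closed[of S \<rho>] assms(1,2) by (simp add: satisfies_def image_subset_iff)
  then show ?case
    using assms(1) inst(1) unfolding satisfies_def eval_subst by blast
qed (use assms(3) in auto)

lemma qi_variety_in_Reg:
  fixes S :: "('a, 'f::field) sig_struct"
  assumes "qi_variety E" and S: "satisfies S E"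
  shows "in_Reg S"
proof -
  define F where "F = presented E ({} :: ('f, nat) trm rel)"
  define p where "p = pres_class E ({} :: ('f, nat) trm rel)"
  have ops: "mult F (p s) (p t) = p (Mult s t)" "diff F (p s) (p t) = p (Diff s t)"
      "qinv F (p t) = p (QInv t)" "scal F c (p t) = p (Scal c t)"
      "one F = p One" "null F = p Zero" "p t \<in> carrier F" for s t c
    by (simp_all add: F_def p_def presented_ops)
  have F: "in_Reg F"
    using assms(1) satisfies_presented unfolding qi_variety_def F_def by blast
  then have Fr: "ring (ring_of F)"
    by (simp add: in_Reg_def)
  define A :: "('f, nat) trm \<Rightarrow> ('f, nat) trm \<Rightarrow> ('f, nat) trm"
    where "A = (\<lambda>s t. Diff s (Diff Zero t))"
  interpret R: ring "ring_of F" by (rule Fr)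
  have rops: "p s \<otimes>\<^bsub>ring_of F\<^esub> p t = p (Mult s t)" "p s \<oplus>\<^bsub>ring_of F\<^esub> p t = p (A s t)"
     "\<one>\<^bsub>ring_of F\<^esub> = p One" "\<zero>\<^bsub>ring_of F\<^esub> = p Zero" "p s \<in> carrier (ring_of F)" for s t
    by (simp_all add: ring_of_def ops A_def)
  have H: "\<forall>x\<in>carrier F. \<forall>y\<in>carrier F. diff F x y = x \<ominus>\<^bsub>ring_of F\<^esub> y"
      "\<forall>c. \<forall>x\<in>carrier F. \<forall>y\<in>carrier F.
        scal F c (x \<oplus>\<^bsub>ring_of F\<^esub> y) = scal F c x \<oplus>\<^bsub>ring_of F\<^esub> scal F c y \<and>
        scal F c (mult F x y) = mult F (scal F c x) y \<and>
        scal F c (mult F x y) = mult F x (scal F c y)"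
      "\<forall>c d. \<forall>x\<in>carrier F.
        scal F (c + d) x = scal F c x \<oplus>\<^bsub>ring_of F\<^esub> scal F d x \<and>
        scal F (c * d) x = scal F c (scal F d x)"
      "\<forall>x\<in>carrier F. scal F 1 x = x \<and> mult F (mult F x (qinv F x)) x = x"
    subgoal using F unfolding in_Reg_def by (elim conjE)
    subgoal using F unfolding in_Reg_def by (elim conjE)
    subgoal using F unfolding in_Reg_def by (elim conjE)
    subgoal using F unfolding in_Reg_def by (elim conjE)
    done
  have G: "diff F g h = g \<ominus>\<^bsub>ring_of F\<^esub> h"
     "scal F c (g \<oplus>\<^bsub>ring_of F\<^esub> h) = scal F c g \<oplus>\<^bsub>ring_of F\<^esub> scal F c h"
     "scal F c (mult F g h) = mult F (scal F c g) h" "scal F c (mult F g h) = mult F g (scal F c h)"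
     "scal F (c + d) g = scal F c g \<oplus>\<^bsub>ring_of F\<^esub> scal F d g"
     "scal F (c * d) g = scal F c (scal F d g)"
     "scal F 1 g = g" "mult F (mult F g (qinv F g)) g = g"
    if "g \<in> carrier F" "h \<in> carrier F" for c d g h
    subgoal using H(1)[rule_format, OF that] .
    subgoal using H(2)[rule_format, OF that, of c] by (elim conjE)
    subgoal using H(2)[rule_format, OF that, of c] by (elim conjE)
    subgoal using H(2)[rule_format, OF that, of c] by (elim conjE)
    subgoal using H(3)[rule_format, OF that(1), of c d] by (elim conjE)
    subgoal using H(3)[rule_format, OF that(1), of c d] by (elim conjE)
    subgoal using H(4)[rule_format, OF that(1)] by (elim conjE)
    subgoal using H(4)[rule_format, OF that(1)] by (elim conjE)
    done
  have dm: "p (Diff s t) = p s \<ominus>\<^bsub>ring_of F\<^esub> p t" for s t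
    using G(1)[OF ops(7) ops(7), of s t] by (simp only: ops(2))
  have neg: "p (Diff Zero t) = \<ominus>\<^bsub>ring_of F\<^esub> p t" for t
    using dm[of Zero t] R.a_inv_closed[OF rops(5)[of t]] by (simp add: R.minus_eq flip: rops(4))
  have F2: "p (A (A s t) u) = p (A s (A t u))" "p (A s t) = p (A t s)" "p (A Zero s) = p s"
     "p (A (Diff Zero s) s) = p Zero" "p (Diff s t) = p (A s (Diff Zero t))"
     "p (Mult (Mult s t) u) = p (Mult s (Mult t u))" "p (Mult One s) = p s" "p (Mult s One) = p s"
     "p (Mult (A s t) u) = p (A (Mult s u) (Mult t u))"
     "p (Mult u (A s t)) = p (A (Mult u s) (Mult u t))" for s t u
    subgoal using R.a_assoc[of "p s" "p t" "p u"] by (simp add: rops)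
    subgoal using R.a_comm[of "p s" "p t"] by (simp add: rops)
    subgoal using R.l_zero[of "p s"] by (simp add: rops)
    subgoal using R.l_neg[of "p s"] by (simp add: rops flip: neg)
    subgoal using dm[of s t] by (simp add: R.minus_eq rops flip: neg)
    subgoal using R.m_assoc[of "p s" "p t" "p u"] by (simp add: rops)
    subgoal using R.l_one[of "p s"] by (simp add: rops)
    subgoal using R.r_one[of "p s"] by (simp add: rops)
    subgoal using R.l_distr[of "p s" "p t" "p u"] by (simp add: rops)
    subgoal using R.r_distr[of "p s" "p t" "p u"] by (simp add: rops)
    done
  have F3: "p (Scal c (A s t)) = p (A (Scal c s) (Scal c t))"
     "p (Scal c (Mult s t)) = p (Mult (Scal c s) t)" "p (Scal c (Mult s t)) = p (Mult s (Scal c t))"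
     "p (Scal (c + d) s) = p (A (Scal c s) (Scal d s))" "p (Scal (c * d) s) = p (Scal c (Scal d s))"
     "p (Scal 1 s) = p s" "p (Mult (Mult s (QInv s)) s) = p s" for c d s t
    subgoal using G(2)[OF ops(7)[of s] ops(7)[of t], of c] by (simp only: ops(1-4) rops(2))
    subgoal using G(3)[OF ops(7)[of s] ops(7)[of t], of c] by (simp only: ops(1-4) rops(2))
    subgoal using G(4)[OF ops(7)[of s] ops(7)[of t], of c] by (simp only: ops(1-4) rops(2))
    subgoal using G(5)[OF ops(7)[of s] ops(7)[of t], of c d] by (simp only: ops(1-4) rops(2))
    subgoal using G(6)[OF ops(7)[of s] ops(7)[of t], of c d] by (simp only: ops(1-4) rops(2))
    subgoal using G(7)[OF ops(7)[of s] ops(7)[of t]] by (simp only: ops(1-4) rops(2))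
    subgoal using G(8)[OF ops(7)[of s] ops(7)[of t]] by (simp only: ops(1-4) rops(2))
    done
  have tr: "eval S \<rho> s = eval S \<rho> t" if "p s = p t" "range \<rho> \<subseteq> carrier S" for s t \<rho>
    using pres_eq_sound[OF S that(2), of "{}" s t] that(1) by (simp add: p_def pres_class_eq_iff)
  have cl: "sig_closed S"
    using S by (simp add: satisfies_def)
  define \<rho> where "\<rho> = (\<lambda>x y z (n::nat). if n = 0 then x else if n = 1 then y else z :: 'a)"
  have \<rho>: "range (\<rho> x y z) \<subseteq> carrier S" if "x \<in> carrier S" "y \<in> carrier S" "z \<in> carrier S" for x y z
    using that by (auto simp: \<rho>_def)
  have \<rho>n: "\<rho> x y z 0 = x" "\<rho> x y z 1 = y" "\<rho> x y z 2 = z" for x y z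
    by (auto simp: \<rho>_def)
  define a where "a = (\<lambda>x y. diff S x (diff S (null S) y))"
  have evA: "eval S r (A s t) = a (eval S r s) (eval S r t)" for r s t
    by (simp add: A_def a_def)
  define x where "x = (Var 0 :: ('f, nat) trm)"
  define y where "y = (Var 1 :: ('f, nat) trm)"
  define z where "z = (Var 2 :: ('f, nat) trm)"
  note ev = evA x_def y_def z_def \<rho>n
  have S2: "a (a s t) u = a s (a t u)" "a s t = a t s" "a (null S) s = s"
     "a (diff S (null S) s) s = null S" "diff S s t = a s (diff S (null S) t)"
     "mult S (mult S s t) u = mult S s (mult S t u)" "mult S (one S) s = s" "mult S s (one S) = s"
     "mult S (a s t) u = a (mult S s u) (mult S t u)"
     "mult S u (a s t) = a (mult S u s) (mult S u t)"
     "scal S c (a s t) = a (scal S c s) (scal S c t)"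
     "scal S c (mult S s t) = mult S (scal S c s) t" "scal S c (mult S s t) = mult S s (scal S c t)"
     "scal S (c + d) s = a (scal S c s) (scal S d s)" "scal S (c * d) s = scal S c (scal S d s)"
     "scal S 1 s = s" "mult S (mult S s (qinv S s)) s = s"
    if "s \<in> carrier S" "t \<in> carrier S" "u \<in> carrier S" for s t u c d
    subgoal using tr[OF F2(1)[of x y z] \<rho>[OF that]] by (simp only: eval.simps ev)
    subgoal using tr[OF F2(2)[of x y] \<rho>[OF that]] by (simp only: eval.simps ev)
    subgoal using tr[OF F2(3)[of x] \<rho>[OF that]] by (simp only: eval.simps ev)
    subgoal using tr[OF F2(4)[of x] \<rho>[OF that]] by (simp only: eval.simps ev)
    subgoal using tr[OF F2(5)[of x y] \<rho>[OF that]] by (simp only: eval.simps ev)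
    subgoal using tr[OF F2(6)[of x y z] \<rho>[OF that]] by (simp only: eval.simps ev)
    subgoal using tr[OF F2(7)[of x] \<rho>[OF that]] by (simp only: eval.simps ev)
    subgoal using tr[OF F2(8)[of x] \<rho>[OF that]] by (simp only: eval.simps ev)
    subgoal using tr[OF F2(9)[of x y z] \<rho>[OF that]] by (simp only: eval.simps ev)
    subgoal using tr[OF F2(10)[of z x y] \<rho>[OF that]] by (simp only: eval.simps ev)
    subgoal using tr[OF F3(1)[of c x y] \<rho>[OF that]] by (simp only: eval.simps ev)
    subgoal using tr[OF F3(2)[of c x y] \<rho>[OF that]] by (simp only: eval.simps ev)
    subgoal using tr[OF F3(3)[of c x y] \<rho>[OF that]] by (simp only: eval.simps ev)
    subgoal using tr[OF F3(4)[of c d x] \<rho>[OF that]] by (simp only: eval.simps ev)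
    subgoal using tr[OF F3(5)[of c d x] \<rho>[OF that]] by (simp only: eval.simps ev)
    subgoal using tr[OF F3(6)[of x] \<rho>[OF that]] by (simp only: eval.simps ev)
    subgoal using tr[OF F3(7)[of x] \<rho>[OF that]] by (simp only: eval.simps ev)
    done
  have rS: "carrier (ring_of S) = carrier S" "monoid.mult (ring_of S) = mult S"
      "\<one>\<^bsub>ring_of S\<^esub> = one S" "\<zero>\<^bsub>ring_of S\<^esub> = null S" "add (ring_of S) = a"
    by (simp_all add: ring_of_def a_def)
  have c: "null S \<in> carrier S" "one S \<in> carrier S"
      "\<And>s t. s \<in> carrier S \<Longrightarrow> t \<in> carrier S \<Longrightarrow> diff S s t \<in> carrier S"
      "\<And>s t. s \<in> carrier S \<Longrightarrow> t \<in> carrier S \<Longrightarrow> a s t \<in> carrier S"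
      "\<And>s t. s \<in> carrier S \<Longrightarrow> t \<in> carrier S \<Longrightarrow> mult S s t \<in> carrier S"
    using cl by (auto simp: sig_closed_def a_def)
  have ab: "abelian_group (ring_of S)"
  proof (rule abelian_groupI, unfold rS)
    fix s assume s: "s \<in> carrier S"
    show "\<exists>t\<in>carrier S. a t s = null S"
      using S2(4)[OF s s s] c(3)[OF c(1) s] by blast
  qed (rule c(1) | (rule c(4) S2(1-3); assumption))+
  have mo: "monoid (ring_of S)"
    by (rule monoidI, unfold rS) (rule c(2) | (rule c(5) S2(6-8); assumption))+
  have ri: "ring (ring_of S)"
    by (rule ringI[OF ab mo], unfold rS) (rule S2(9,10); assumption)+
  interpret T: ring "ring_of S" by (rule ri)
  have D: "diff S s t = s \<ominus>\<^bsub>ring_of S\<^esub> t" if "s \<in> carrier S" "t \<in> carrier S" for s t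
  proof -
    have "\<ominus>\<^bsub>ring_of S\<^esub> t = diff S (null S) t"
      using T.minus_equality[of "diff S (null S) t" t] S2(4)[OF that(2) that(2) that(2)]
        c(3)[OF c(1) that(2)] that(2) by (simp only: rS)
    then show ?thesis
      using S2(5)[OF that that(2)] by (simp only: T.minus_eq rS)
  qed
  then show ?thesis
    by (unfold in_Reg_def rS, intro conjI ballI allI) (rule cl ri D S2(11-17); assumption)+
qed


section \<open>The algebra of 3 by 3 matrices\<close>

definition mscale :: "'f::field \<Rightarrow> 'f^3^3 \<Rightarrow> 'f^3^3" where
  "mscale c X = map_matrix ((*) c) X"

definition matA :: "'f::field^3^3" where
  "matA = vector [vector [1, 0, 0], vector [0, 0, 0], vector [0, 0, 0]]"

definition matB :: "'f::field^3^3" where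
  "matB = vector [vector [1, 0, 1], vector [0, 1, 0], vector [0, 0, 0]]"

inductive_set gen_subalg :: "'f::field^3^3 \<Rightarrow> ('f^3^3) set" for M :: "'f::field^3^3" where
  "M \<in> gen_subalg M"
| "mat 1 \<in> gen_subalg M"
| "X \<in> gen_subalg M \<Longrightarrow> Y \<in> gen_subalg M \<Longrightarrow> X - Y \<in> gen_subalg M"
| "X \<in> gen_subalg M \<Longrightarrow> Y \<in> gen_subalg M \<Longrightarrow> X ** Y \<in> gen_subalg M"
| "X \<in> gen_subalg M \<Longrightarrow> mscale c X \<in> gen_subalg M"

definition subalg_family :: "('f::field^3^3) set set" where
  "subalg_family = {range (\<lambda>c. mscale c (mat 1)), gen_subalg matA, gen_subalg matB, UNIV}"

definition admissible_qinv :: "('f::field^3^3 \<Rightarrow> 'f^3^3) \<Rightarrow> bool" where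
  "admissible_qinv q \<longleftrightarrow>
     (\<forall>X. X ** q X ** X = X \<and>
        (\<exists>T\<in>subalg_family. X \<in> T \<and> (\<forall>T'\<in>subalg_family. X \<in> T' \<longrightarrow> T \<subseteq> T') \<and> q X \<in> T))"

definition R_alg :: "('f::field^3^3 \<Rightarrow> 'f^3^3) \<Rightarrow> ('f^3^3, 'f) sig_struct" where
  "R_alg q = \<lparr>carrier = UNIV, monoid.mult = (**), one = mat 1,
              null = 0, diff = (-), qinv = q, scal = mscale\<rparr>"


section \<open>Principal right ideals and Banaschewski measures\<close>

definition pr_ideal :: "('a, 'm) monoid_scheme \<Rightarrow> 'a \<Rightarrow> 'a set" where
  "pr_ideal R x = {x \<otimes>\<^bsub>R\<^esub> r | r. r \<in> carrier R}"

definition pr_lattice :: "('a, 'm) monoid_scheme \<Rightarrow> 'a set gorder" where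
  "pr_lattice R = \<lparr>carrier = pr_ideal R ` carrier R, eq = (=), le = (\<subseteq>)\<rparr>"

text \<open>\<open>m x y\<close> stands for \<open>y \<ominus> x\<close>; only its values for \<open>x \<le> y\<close> in \<open>X\<close> matter.\<close>

definition banaschewski_measure ::
    "('l, 'm) gorder_scheme \<Rightarrow> 'l set \<Rightarrow> ('l \<Rightarrow> 'l \<Rightarrow> 'l) \<Rightarrow> bool" where
  "banaschewski_measure L X m \<longleftrightarrow>
     (\<forall>x\<in>X. \<forall>y\<in>X. x \<sqsubseteq>\<^bsub>L\<^esub> y \<longrightarrow>
        m x y \<in> carrier L \<and> x \<sqinter>\<^bsub>L\<^esub> m x y = \<bottom>\<^bsub>L\<^esub> \<and> x \<squnion>\<^bsub>L\<^esub> m x y = y) \<and>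
     (\<forall>x\<in>X. \<forall>y\<in>X. \<forall>z\<in>X. x \<sqsubseteq>\<^bsub>L\<^esub> y \<longrightarrow> y \<sqsubseteq>\<^bsub>L\<^esub> z \<longrightarrow>
        m x y \<sqsubseteq>\<^bsub>L\<^esub> m x z \<and> m y z \<sqsubseteq>\<^bsub>L\<^esub> m x z)"


section \<open>The first uncountable ordinal\<close>

lemma cardSuc_natLeq:
  includes cardinal_syntax
  shows "Well_order (cardSuc natLeq)" and "uncountable (Field (cardSuc natLeq))"
    and "countable (under (cardSuc natLeq) x)"
proof -
  let ?r = "cardSuc natLeq"
  show wo: "Well_order ?r"
    using cardSuc_Card_order[OF natLeq_Card_order] by (simp add: card_order_on_def)
  have co: "|Field ?r| =o ?r"
    by (rule card_of_Field_ordIso[OF cardSuc_Card_order[OF natLeq_Card_order]])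
  have 1: "|Field ?r| \<le>o natLeq \<longleftrightarrow> countable (Field ?r)"
    by (simp add: countable_card_le_natLeq)
  show "uncountable (Field ?r)"
  proof
    assume "countable (Field ?r)"
    then have "?r \<le>o natLeq"
      using 1 ordIso_ordLeq_trans[OF ordIso_symmetric[OF co]] by simp
    then show False
      using not_ordLess_ordLeq[OF cardSuc_greater[OF natLeq_Card_order]] by simp
  qed
  have us: "countable (underS ?r x)"
  proof (cases "x \<in> Field ?r")
    case True
    have "|underS ?r x| <o ?r"
      by (rule card_of_underS[OF cardSuc_Card_order[OF natLeq_Card_order] True])
    then show ?thesis
      using cardSuc_ordLeq_ordLess[OF natLeq_Card_order card_of_Card_order, of "underS ?r x"]
      by (simp add: countable_card_le_natLeq card_of_ordIso_subst)
  next
    case False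
    then show ?thesis
      by (simp add: underS_empty)
  qed
  have "under ?r x \<subseteq> insert x (underS ?r x)"
    by (auto simp: under_def underS_def)
  then show "countable (under ?r x)"
    by (rule countable_subset) (simp add: us)
qed

typedef omega1 = "Field (cardSuc natLeq)"
  using cardSuc_natLeq(2) by (metis countable_empty ex_in_conv)

instantiation omega1 :: wellorder
begin

definition less_eq_omega1 :: "omega1 \<Rightarrow> omega1 \<Rightarrow> bool" where
  "x \<le> y \<longleftrightarrow> (Rep_omega1 x, Rep_omega1 y) \<in> cardSuc natLeq"

definition less_omega1 :: "omega1 \<Rightarrow> omega1 \<Rightarrow> bool" where
  "x < y \<longleftrightarrow> x \<le> y \<and> x \<noteq> (y :: omega1)"

instance
proof -
  let ?r = "cardSuc natLeq"
  have lin: "Linear_order ?r" and wf: "wf (?r - Id)"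
    using cardSuc_natLeq(1) by (auto simp: well_order_on_def)
  then have refl: "Refl ?r" and tr: "trans ?r" and an: "antisym ?r" and to: "Total ?r"
    by (auto simp: linear_order_on_def partial_order_on_def preorder_on_def)
  have 1: "x \<le> x" for x :: omega1
    using refl Rep_omega1 by (auto simp: less_eq_omega1_def refl_on_def)
  have 2: "x \<le> y \<Longrightarrow> y \<le> z \<Longrightarrow> x \<le> z" for x y z :: omega1
    using transD[OF tr] by (auto simp: less_eq_omega1_def)
  have 3: "x \<le> y \<Longrightarrow> y \<le> x \<Longrightarrow> x = y" for x y :: omega1
    using antisymD[OF an] by (auto simp: less_eq_omega1_def simp flip: Rep_omega1_inject)
  have 4: "x \<le> y \<or> y \<le> x" for x y :: omega1
    using to 1[of x] Rep_omega1[of x] Rep_omega1[of y]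
    by (cases "x = y") (auto simp: less_eq_omega1_def total_on_def Rep_omega1_inject)
  have "{(x, y). x < y} \<subseteq> inv_image (?r - Id) Rep_omega1"
    by (auto simp: less_eq_omega1_def less_omega1_def Rep_omega1_inject)
  then have "wf {(x, y :: omega1). x < y}"
    by (rule wf_subset[OF wf_inv_image[OF wf]])
  then have 5: "(\<And>x. (\<And>y. y < x \<Longrightarrow> P y) \<Longrightarrow> P x) \<Longrightarrow> P a" for P and a :: omega1
    by (rule wf_induct_rule) auto
  show "OFCLASS(omega1, wellorder_class)"
  proof
    fix P :: "omega1 \<Rightarrow> bool" and a
    assume "\<And>x :: omega1. (\<And>y. y < x \<Longrightarrow> P y) \<Longrightarrow> P x"
    then show "P a"
      using 5 by blast
  next
    fix x y z :: omega1
    show "(x < y) = (x \<le> y \<and> \<not> y \<le> x)"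
      using 1 3 by (metis less_omega1_def)
    show "x \<le> x" by (rule 1)
    show "x \<le> y \<Longrightarrow> y \<le> z \<Longrightarrow> x \<le> z" by (rule 2)
    show "x \<le> y \<Longrightarrow> y \<le> x \<Longrightarrow> x = y" by (rule 3)
    show "x \<le> y \<or> y \<le> x" by (rule 4)
  qed
qed

end

lemma uncountable_omega1: "uncountable (UNIV :: omega1 set)"
proof
  assume "countable (UNIV :: omega1 set)"
  then have "countable (range Rep_omega1)"
    by (rule countable_image)
  then show False
    using cardSuc_natLeq(2) by (simp add: type_definition.Rep_range[OF type_definition_omega1])
qed

lemma countable_omega1_less: "countable {..<x :: omega1}"
proof -
  have "Rep_omega1 ` {..<x} \<subseteq> under (cardSuc natLeq) (Rep_omega1 x)"
    by (auto simp: under_def less_eq_omega1_def less_omega1_def)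
  then have "countable (Rep_omega1 ` {..<x})"
    by (rule countable_subset) (rule cardSuc_natLeq(3))
  then show ?thesis
    by (rule countable_image_inj_on) (simp add: inj_on_def Rep_omega1_inject)
qed

end

theory Submission
  imports Defs
begin

text \<open>
  A Banaschewski measure yields projections \<open>a \<xi> \<eta>\<close> of \<open>\<eta>\<close> onto the ideal of \<open>\<xi>\<close>, which satisfy
  \<open>a \<xi> \<zeta> \<cdot> \<eta> = a \<xi> \<eta>\<close> (isotonicity) and \<open>a \<xi> \<zeta> \<cdot> a \<eta> \<zeta> = a \<xi> \<zeta>\<close> (antitonicity) for \<open>\<xi> \<le> \<eta> \<le> \<zeta>\<close>.
  Every element involves only finitely many generators.  By pressing down, there are
  \<open>\<xi> < \<eta> < \<zeta> < \<theta>\<close> such that the support of \<open>a \<xi> \<theta>\<close> avoids \<open>[\<eta>, \<theta>)\<close> and that of \<open>a \<eta> \<zeta>\<close> avoids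
  \<open>[\<xi>, \<eta>)\<close>.  Send the generators below \<open>\<xi>\<close> to 0, those in \<open>[\<xi>, \<eta>)\<close> to \<open>A\<close>, \<open>\<eta>\<close> to \<open>B\<close> and
  those above \<open>\<eta>\<close> to 1.  Then \<open>a \<xi> \<zeta> = a \<xi> \<theta> \<cdot> \<zeta>\<close> is mapped into the subalgebra of \<open>A\<close>, and hence
  to \<open>A\<close>, while \<open>a \<eta> \<zeta>\<close> is mapped to \<open>B\<close>.  So \<open>A B = A\<close>, which is false.
\<close>

section \<open>Principal right ideals of a regular ring\<close>

locale regular_ring = ring R for R (structure) +
  assumes regular: "x \<in> carrier R \<Longrightarrow> \<exists>y\<in>carrier R. x \<otimes> y \<otimes> x = x"
begin

lemma pr_ideal_mem: "x \<in> carrier R \<Longrightarrow> x \<in> pr_ideal R x"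
  unfolding pr_ideal_def by (auto intro!: exI[of _ \<one>])

lemma pr_ideal_closed: "x \<in> carrier R \<Longrightarrow> r \<in> pr_ideal R x \<Longrightarrow> r \<in> carrier R"
  by (auto simp: pr_ideal_def)

lemma pr_ideal_mult:
  "x \<in> carrier R \<Longrightarrow> r \<in> pr_ideal R x \<Longrightarrow> s \<in> carrier R \<Longrightarrow> r \<otimes> s \<in> pr_ideal R x"
  unfolding pr_ideal_def by (auto simp: m_assoc)

lemma pr_ideal_diff:
  assumes "x \<in> carrier R" "r \<in> pr_ideal R x" "s \<in> pr_ideal R x"
  shows "r \<ominus> s \<in> pr_ideal R x"
proof -
  obtain u v where "u \<in> carrier R" "v \<in> carrier R" "r = x \<otimes> u" "s = x \<otimes> v"
    using assms by (auto simp: pr_ideal_def)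
  with assms(1) show ?thesis
    by (auto simp: pr_ideal_def minus_eq r_distr r_minus intro!: exI[of _ "u \<ominus> v"])
qed

lemma pr_ideal_add:
  assumes "x \<in> carrier R" "r \<in> pr_ideal R x" "s \<in> pr_ideal R x"
  shows "r \<oplus> s \<in> pr_ideal R x"
proof -
  obtain u v where "u \<in> carrier R" "v \<in> carrier R" "r = x \<otimes> u" "s = x \<otimes> v"
    using assms by (auto simp: pr_ideal_def)
  with assms(1) show ?thesis
    by (auto simp: pr_ideal_def r_distr intro!: exI[of _ "u \<oplus> v"])
qed

lemma pr_ideal_subset:
  "x \<in> carrier R \<Longrightarrow> r \<in> pr_ideal R x \<Longrightarrow> pr_ideal R r \<subseteq> pr_ideal R x"
  using pr_ideal_mult by (auto simp: pr_ideal_def[of R r])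

lemma pr_ideal_idem_mem:
  assumes "e \<in> carrier R" "e \<otimes> e = e" "r \<in> carrier R"
  shows "r \<in> pr_ideal R e \<longleftrightarrow> e \<otimes> r = r"
  using assms by (auto simp: pr_ideal_def simp flip: m_assoc) metis

lemma mult_minus_eq_zero:
  assumes "a \<in> carrier R" "b \<in> carrier R" "c \<in> carrier R" "a \<otimes> b = a \<otimes> c"
  shows "a \<otimes> (b \<ominus> c) = \<zero>"
  using assms by (simp add: minus_eq r_distr r_minus r_neg)

lemma eq_of_minus_zero: "a \<in> carrier R \<Longrightarrow> b \<in> carrier R \<Longrightarrow> a \<ominus> b = \<zero> \<Longrightarrow> a = b"
  by (metis minus_eq minus_equality minus_minus a_inv_closed)

section \<open>Idempotent generators, intersections and sums of principal right ideals\<close>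

text \<open>The equations \<open>e = x \<otimes> x'\<close> and \<open>e \<otimes> x = x\<close>
  together say that \<open>e\<close> and \<open>x\<close> generate the same right ideal.\<close>

lemma ex_idem:
  assumes x: "x \<in> carrier R"
  obtains e x' where "e \<in> carrier R" "x' \<in> carrier R" "e = x \<otimes> x'" "e \<otimes> e = e" "e \<otimes> x = x"
proof -
  obtain x' where "x' \<in> carrier R" "x \<otimes> x' \<otimes> x = x"
    using regular[OF x] by blast
  with x show thesis
    by (intro that[of "x \<otimes> x'" x']) (simp_all flip: m_assoc)
qed

text \<open>With \<open>e\<close> an idempotent generator of \<open>yR\<close> and
  \<open>u = x - ex\<close>, an element \<open>xs\<close> lies in \<open>yR\<close> iff
  \<open>us = 0\<close>. The right annihilator of \<open>u\<close> is generated by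
  \<open>1 - u'u\<close>, so \<open>x(1 - u'u)\<close> generates the intersection.\<close>

lemma pr_ideal_Int:
  assumes x: "x \<in> carrier R" and y: "y \<in> carrier R"
  shows "\<exists>z\<in>carrier R. pr_ideal R z = pr_ideal R x \<inter> pr_ideal R y"
proof -
  obtain e y' where e: "e \<in> carrier R" "y' \<in> carrier R" "e = y \<otimes> y'" "e \<otimes> e = e" "e \<otimes> y = y"
    by (rule ex_idem[OF y])
  define u where "u = x \<ominus> e \<otimes> x"
  have u: "u \<in> carrier R"
    using x e by (simp add: u_def)
  obtain u' where u': "u' \<in> carrier R" "u \<otimes> u' \<otimes> u = u"
    using regular[OF u] by blast
  define z where "z = x \<otimes> (\<one> \<ominus> u' \<otimes> u)"
  have z: "z \<in> carrier R"
    using x u u' by (simp add: z_def)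
  have zx: "z \<in> pr_ideal R x"
    using x u u' by (simp add: z_def pr_ideal_mult pr_ideal_mem)
  have "z \<ominus> e \<otimes> z = u \<otimes> (\<one> \<ominus> u' \<otimes> u)"
    unfolding z_def u_def using x e(1) u u'(1)
    by (simp add: minus_eq l_distr l_minus m_assoc)
  also have "\<dots> = \<zero>"
    using u u' by (intro mult_minus_eq_zero) (simp_all add: m_assoc)
  finally have "e \<otimes> z = z"
    using eq_of_minus_zero[of z "e \<otimes> z"] z e(1) by simp
  then have "z = y \<otimes> (y' \<otimes> z)"
    using y z e(2) by (simp add: e(3) m_assoc)
  then have zy: "z \<in> pr_ideal R y"
    using z e(2) by (auto simp: pr_ideal_def)
  have "r \<in> pr_ideal R z" if rx: "r \<in> pr_ideal R x" and ry: "r \<in> pr_ideal R y" for r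
  proof -
    obtain s where s: "s \<in> carrier R" "r = x \<otimes> s"
      using rx by (auto simp: pr_ideal_def)
    obtain t where t: "t \<in> carrier R" "r = y \<otimes> t"
      using ry by (auto simp: pr_ideal_def)
    have "e \<otimes> r = r"
      using e y t by (simp flip: m_assoc)
    then have "u \<otimes> s = \<zero>"
      using x e(1) s by (simp add: u_def minus_eq l_distr l_minus m_assoc r_neg)
    then have "z \<otimes> s = r"
      using x u u'(1) s by (simp add: z_def minus_eq l_distr r_distr l_minus r_minus m_assoc)
    then show ?thesis
      using s(1) by (auto simp: pr_ideal_def)
  qed
  then show ?thesis
    using z pr_ideal_subset[OF x zx] pr_ideal_subset[OF y zy] by blast
qed

text \<open>The two memberships give \<open>xR + yR \<subseteq> sR\<close>, and the decomposition of
  \<open>s\<close> gives the converse. Replacing \<open>y\<close> by \<open>u = y - ex'\<close>-free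
  part, that is \<open>u = y - ey\<close>, leaves the sum unchanged and makes \<open>e\<close>
  annihilate it.\<close>

lemma pr_ideal_sum:
  assumes x: "x \<in> carrier R" and y: "y \<in> carrier R"
  shows "\<exists>s\<in>carrier R. x \<in> pr_ideal R s \<and> y \<in> pr_ideal R s \<and>
    (\<exists>a\<in>pr_ideal R x. \<exists>b\<in>pr_ideal R y. s = a \<oplus> b)"
proof -
  obtain e x' where e: "e \<in> carrier R" "x' \<in> carrier R" "e = x \<otimes> x'" "e \<otimes> e = e" "e \<otimes> x = x"
    by (rule ex_idem[OF x])
  define u where "u = y \<ominus> e \<otimes> y"
  have u: "u \<in> carrier R"
    using y e by (simp add: u_def)
  have eu: "e \<otimes> u = \<zero>"
    unfolding u_def using y e by (intro mult_minus_eq_zero) (simp_all flip: m_assoc)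
  obtain g u' where g: "g \<in> carrier R" "u' \<in> carrier R" "g = u \<otimes> u'" "g \<otimes> g = g" "g \<otimes> u = u"
    by (rule ex_idem[OF u])
  have eg: "e \<otimes> g = \<zero>"
    using e(1) u g(2) eu by (simp add: g(3) flip: m_assoc)
  define c where "c = \<one> \<ominus> e"
  have c: "c \<in> carrier R" "c \<otimes> e = \<zero>" "c \<otimes> g = g"
    using e(1,4) g(1) eg by (simp_all add: c_def minus_eq l_distr l_minus r_neg)
  \<comment> \<open>Here \<open>eg = 0\<close>, but \<open>ge\<close> need not vanish. The factor
    \<open>c = 1 - e\<close> kills \<open>e\<close> on the right of \<open>g\<close> and fixes
    \<open>g\<close> from the left, so that \<open>s\<close> acts as identity on both
    \<open>e\<close> and \<open>g\<close>.\<close>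
  define s where "s = e \<oplus> g \<otimes> c"
  have s: "s \<in> carrier R" "s \<otimes> e = e" "s \<otimes> g = g"
    using e(1,4) g(1,4) c eg by (simp_all add: s_def l_distr m_assoc)
  have sx: "s \<otimes> x = x"
    using s(1,2) e(1,5) x by (metis m_assoc)
  have su: "s \<otimes> u = u"
    using s(1,3) g(1,5) u by (metis m_assoc)
  have yu: "y = e \<otimes> y \<oplus> u"
    using e(1) y by (simp add: u_def minus_eq a_ac r_neg)
  have "s \<otimes> (e \<otimes> y) = e \<otimes> y"
    using s(1,2) e(1) y by (simp flip: m_assoc)
  then have "s \<otimes> y = e \<otimes> y \<oplus> u"
    using s(1) e(1) u y su by (subst yu) (simp add: r_distr)
  with yu have sy: "s \<otimes> y = y"
    by simp
  \<comment> \<open>Expanding \<open>gc = (y - ey)u'c\<close> separates a summand in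
    \<open>xR\<close> from one in \<open>yR\<close>.\<close>
  have "s = (e \<ominus> e \<otimes> (y \<otimes> (u' \<otimes> c))) \<oplus> y \<otimes> (u' \<otimes> c)"
    using e(1) u g(2) c(1) y by (simp add: s_def g(3) u_def minus_eq l_distr l_minus m_assoc a_ac)
  moreover have "e \<in> pr_ideal R x"
    using e by (auto simp: pr_ideal_def)
  then have "e \<ominus> e \<otimes> (y \<otimes> (u' \<otimes> c)) \<in> pr_ideal R x"
    using x y g(2) c(1) by (intro pr_ideal_diff pr_ideal_mult) simp_all
  moreover have "y \<otimes> (u' \<otimes> c) \<in> pr_ideal R y"
    using g(2) c(1) by (auto simp: pr_ideal_def)
  moreover have "x \<in> pr_ideal R s" "y \<in> pr_ideal R s"
    using sx sy x y by (auto simp: pr_ideal_def intro: exI[of _ x] exI[of _ y])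
  ultimately show ?thesis
    using s(1) by blast
qed

section \<open>Bottom, meets and joins in the lattice of principal right ideals\<close>

lemma pr_lattice_simps:
  "carrier (pr_lattice R) = pr_ideal R ` carrier R" "le (pr_lattice R) = (\<subseteq>)"
  by (simp_all add: pr_lattice_def)

text \<open>Bottom, meet and join are Hilbert choices of extremal elements; antisymmetry makes these
  unique, so each can be computed from one candidate.\<close>

lemma partial_order_pr_lattice: "partial_order (pr_lattice R)"
  by unfold_locales (auto simp: pr_lattice_def)

lemma pr_bottom: "\<bottom>\<^bsub>pr_lattice R\<^esub> = {\<zero>}"
proof -
  interpret L: partial_order "pr_lattice R"
    by (rule partial_order_pr_lattice)
  have z: "pr_ideal R \<zero> = {\<zero>}"
    by (auto simp: pr_ideal_def intro!: exI[of _ \<zero>])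
  have "\<zero> \<in> pr_ideal R x" if "x \<in> carrier R" for x
    using that by (auto simp: pr_ideal_def intro!: exI[of _ \<zero>])
  then have l: "least (pr_lattice R) {\<zero>} (carrier (pr_lattice R))"
    using z by (auto simp: least_def pr_lattice_simps intro!: image_eqI[of _ _ \<zero>])
  then show ?thesis
    unfolding bottom_def by (rule some_equality[OF _ L.least_unique[OF _ l]])
qed

lemma pr_meet:
  assumes "x \<in> carrier R" "y \<in> carrier R"
  shows "pr_ideal R x \<sqinter>\<^bsub>pr_lattice R\<^esub> pr_ideal R y = pr_ideal R x \<inter> pr_ideal R y"
proof -
  interpret L: partial_order "pr_lattice R"
    by (rule partial_order_pr_lattice)
  have "pr_ideal R x \<inter> pr_ideal R y \<in> carrier (pr_lattice R)"
    using pr_ideal_Int[OF assms] by (auto simp: pr_lattice_simps)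
  then have g: "is_glb (pr_lattice R) (pr_ideal R x \<inter> pr_ideal R y) {pr_ideal R x, pr_ideal R y}"
    using assms by (auto simp: greatest_def Lower_def pr_lattice_simps)
  then show ?thesis
    unfolding meet_def inf_def by (rule some_equality[OF _ L.greatest_unique[OF _ g]])
qed

text \<open>The join is generated by the \<open>s\<close> of \<open>pr_ideal_sum\<close>: a right
  ideal containing \<open>x\<close> and \<open>y\<close> contains \<open>s = a + b\<close>.
  Multiplying this decomposition by \<open>t\<close> splits an arbitrary element
  \<open>st\<close>.\<close>

lemma pr_join:
  assumes x: "x \<in> carrier R" and y: "y \<in> carrier R"
    and r: "r \<in> pr_ideal R x \<squnion>\<^bsub>pr_lattice R\<^esub> pr_ideal R y"
  shows "\<exists>a\<in>pr_ideal R x. \<exists>b\<in>pr_ideal R y. r = a \<oplus> b"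
proof -
  interpret L: partial_order "pr_lattice R"
    by (rule partial_order_pr_lattice)
  obtain s a b where s: "s \<in> carrier R" "x \<in> pr_ideal R s" "y \<in> pr_ideal R s"
      and ab: "a \<in> pr_ideal R x" "b \<in> pr_ideal R y" "s = a \<oplus> b"
    using pr_ideal_sum[OF x y] by blast
  have ub: "pr_ideal R s \<subseteq> pr_ideal R t"
    if "t \<in> carrier R" "pr_ideal R x \<subseteq> pr_ideal R t" "pr_ideal R y \<subseteq> pr_ideal R t" for t
  proof -
    have "s \<in> pr_ideal R t"
      unfolding ab(3) using ab(1,2) that(2,3) by (intro pr_ideal_add[OF that(1)]) blast+
    then show ?thesis
      by (rule pr_ideal_subset[OF that(1)])
  qed
  have sub: "pr_ideal R x \<subseteq> pr_ideal R s" "pr_ideal R y \<subseteq> pr_ideal R s"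
    by (rule pr_ideal_subset[OF s(1) s(2)], rule pr_ideal_subset[OF s(1) s(3)])
  have l: "is_lub (pr_lattice R) (pr_ideal R s) {pr_ideal R x, pr_ideal R y}"
  proof (rule least_UpperI)
    fix M assume "M \<in> Upper (pr_lattice R) {pr_ideal R x, pr_ideal R y}"
    then have "\<exists>t\<in>carrier R. M = pr_ideal R t \<and> pr_ideal R x \<subseteq> M \<and> pr_ideal R y \<subseteq> M"
      using x y by (simp add: Upper_def pr_lattice_simps) blast
    then show "pr_ideal R s \<sqsubseteq>\<^bsub>pr_lattice R\<^esub> M"
      using ub by (auto simp only: pr_lattice_simps)
  qed (use sub x y s(1) in \<open>auto simp only: pr_lattice_simps\<close>)
  then have "pr_ideal R x \<squnion>\<^bsub>pr_lattice R\<^esub> pr_ideal R y = pr_ideal R s"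
    unfolding join_def sup_def by (rule some_equality[OF _ L.least_unique[OF _ l]])
  then obtain t where t: "t \<in> carrier R" "r = s \<otimes> t"
    using r by (auto simp: pr_ideal_def)
  then have "r = a \<otimes> t \<oplus> b \<otimes> t"
    using pr_ideal_closed[OF x ab(1)] pr_ideal_closed[OF y ab(2)] by (simp add: ab(3) l_distr)
  then show ?thesis
    using pr_ideal_mult[OF x ab(1) t(1)] pr_ideal_mult[OF y ab(2) t(1)] by blast
qed

section \<open>From lattice complements to projections\<close>

lemma pr_direct_sum:
  assumes x: "x \<in> carrier R" and M: "M \<in> carrier (pr_lattice R)" and y: "y \<in> carrier R"
    and meet: "pr_ideal R x \<sqinter>\<^bsub>pr_lattice R\<^esub> M = \<bottom>\<^bsub>pr_lattice R\<^esub>"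
    and join: "pr_ideal R x \<squnion>\<^bsub>pr_lattice R\<^esub> M = pr_ideal R y"
  shows "pr_ideal R x \<inter> M = {\<zero>}" and "\<exists>a\<in>pr_ideal R x. y \<ominus> a \<in> M"
proof -
  obtain w where w: "w \<in> carrier R" "M = pr_ideal R w"
    using M by (auto simp: pr_lattice_simps)
  show "pr_ideal R x \<inter> M = {\<zero>}"
    using meet pr_meet[OF x w(1)] by (simp add: w(2) pr_bottom)
  obtain a b where ab: "a \<in> pr_ideal R x" "b \<in> M" "y = a \<oplus> b"
    using pr_join[OF x w(1), of y] join pr_ideal_mem[OF y] by (auto simp: w(2))
  have "a \<in> carrier R" "b \<in> carrier R"
    using pr_ideal_closed[OF x ab(1)] pr_ideal_closed[OF w(1)] ab(2) w(2) by auto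
  then have "y \<ominus> a = b"
    by (simp add: ab(3) minus_eq a_comm[of a b] a_assoc r_neg)
  then show "\<exists>a\<in>pr_ideal R x. y \<ominus> a \<in> M"
    using ab by (intro bexI[of _ a]) simp_all
qed

text \<open>Since \<open>f'f = f\<close>, the element \<open>a'f - a\<close> equals
  \<open>(f - a) - (f' - a')f\<close>. It thus lies in both \<open>eR\<close> and \<open>wR\<close>,
  which meet in zero.\<close>

lemma complement_projection_mult:
  assumes e: "e \<in> carrier R" and f: "f \<in> carrier R" and f': "f' \<in> carrier R" "f' \<otimes> f = f"
    and w: "w \<in> carrier R" "pr_ideal R e \<inter> pr_ideal R w = {\<zero>}"
    and a: "a \<in> pr_ideal R e" "f \<ominus> a \<in> pr_ideal R w"
    and a': "a' \<in> pr_ideal R e" "f' \<ominus> a' \<in> pr_ideal R w"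
  shows "a' \<otimes> f = a"
proof -
  have c: "a \<in> carrier R" "a' \<in> carrier R"
    using pr_ideal_closed[OF e] a(1) a'(1) by auto
  have "a' \<otimes> f \<ominus> a \<in> pr_ideal R e"
    by (intro pr_ideal_diff pr_ideal_mult e f a(1) a'(1))
  moreover have "(f \<ominus> a) \<ominus> (f' \<ominus> a') \<otimes> f \<in> pr_ideal R w"
    by (intro pr_ideal_diff pr_ideal_mult w(1) f a(2) a'(2))
  moreover have "(f \<ominus> a) \<ominus> (f' \<ominus> a') \<otimes> f = a' \<otimes> f \<ominus> a"
  proof -
    have "(f \<ominus> a) \<ominus> (f' \<ominus> a') \<otimes> f = (f \<oplus> \<ominus> f) \<oplus> (a' \<otimes> f \<ominus> a)"
      using c f f' by (simp add: minus_eq l_distr l_minus minus_add a_ac)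
    then show ?thesis
      using c f by (simp add: r_neg)
  qed
  ultimately have "a' \<otimes> f \<ominus> a = \<zero>"
    using w(2) by auto
  then show ?thesis
    using c f eq_of_minus_zero by simp
qed

text \<open>Since \<open>fr = r\<close>, the element \<open>ar\<close> of \<open>eR\<close> equals
  \<open>r - (f - a)r\<close>, which lies in \<open>wR\<close>.\<close>

lemma complement_projection_zero:
  assumes e: "e \<in> carrier R" and w: "w \<in> carrier R" "pr_ideal R e \<inter> pr_ideal R w = {\<zero>}"
    and f: "f \<in> carrier R" and a: "a \<in> pr_ideal R e" "f \<ominus> a \<in> pr_ideal R w"
    and r: "r \<in> pr_ideal R w" "f \<otimes> r = r"
  shows "a \<otimes> r = \<zero>"
proof -
  have c: "a \<in> carrier R" "r \<in> carrier R"
    using pr_ideal_closed e a(1) w(1) r(1) by auto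
  have "a \<otimes> r \<in> pr_ideal R e"
    by (intro pr_ideal_mult e a(1) c)
  moreover have "r \<ominus> (f \<ominus> a) \<otimes> r \<in> pr_ideal R w"
    by (intro pr_ideal_diff pr_ideal_mult w(1) a(2) r(1) c)
  moreover have "r \<ominus> (f \<ominus> a) \<otimes> r = a \<otimes> r"
  proof -
    have "r \<ominus> (f \<ominus> a) \<otimes> r = (r \<oplus> \<ominus> r) \<oplus> a \<otimes> r"
      using c f r(2) by (simp add: minus_eq l_distr l_minus minus_add a_ac)
    then show ?thesis
      using c by (simp add: r_neg)
  qed
  ultimately show ?thesis
    using w(2) by auto
qed

text \<open>\<open>a i j\<close> is the projection of \<open>e j\<close> onto \<open>e i R\<close> along the difference of \<open>e j R\<close> and \<open>e i R\<close>.\<close>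

lemma banaschewski_projections:
  fixes e :: "'i::linorder \<Rightarrow> 'a"
  assumes e: "\<And>i. e i \<in> carrier R" and le: "\<And>i j. i \<le> j \<Longrightarrow> e j \<otimes> e i = e i"
    and m: "banaschewski_measure (pr_lattice R) {pr_ideal R (e i) | i. True} m"
  obtains a where "\<And>i j. i \<le> j \<Longrightarrow> a i j \<in> carrier R"
    and "\<And>i j. i \<le> j \<Longrightarrow> e i \<otimes> a i j = a i j"
    and "\<And>i j. i \<le> j \<Longrightarrow> a i j \<otimes> e i = e i"
    and "\<And>i j k. i \<le> j \<Longrightarrow> j \<le> k \<Longrightarrow> a i k \<otimes> e j = a i j"
    and "\<And>i j k. i \<le> j \<Longrightarrow> j \<le> k \<Longrightarrow> a i k \<otimes> a j k = a i k"
proof -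
  define M where "M i j = m (pr_ideal R (e i)) (pr_ideal R (e j))" for i j
  have sub: "pr_ideal R (e i) \<subseteq> pr_ideal R (e j)" if "i \<le> j" for i j
    using le[OF that] e by (intro pr_ideal_subset) (auto simp: pr_ideal_def intro!: exI[of _ "e i"])
  have M: "M i j \<in> carrier (pr_lattice R)"
      "pr_ideal R (e i) \<sqinter>\<^bsub>pr_lattice R\<^esub> M i j = \<bottom>\<^bsub>pr_lattice R\<^esub>"
      "pr_ideal R (e i) \<squnion>\<^bsub>pr_lattice R\<^esub> M i j = pr_ideal R (e j)" if "i \<le> j" for i j
    using m sub[OF that] unfolding banaschewski_measure_def M_def pr_lattice_simps by blast+
  let ?X = "{pr_ideal R (e i) | i. True}"
  have X: "pr_ideal R (e i) \<in> ?X" for i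
    by blast
  have "\<forall>x\<in>?X. \<forall>y\<in>?X. \<forall>z\<in>?X. x \<subseteq> y \<longrightarrow> y \<subseteq> z \<longrightarrow> m x y \<subseteq> m x z \<and> m y z \<subseteq> m x z"
    using m unfolding banaschewski_measure_def pr_lattice_simps by (rule conjunct2)
  note isotone = this[THEN bspec, OF X, THEN bspec, OF X, THEN bspec, OF X, rule_format]
  have mono: "M i j \<subseteq> M i k" "M j k \<subseteq> M i k" if "i \<le> j" "j \<le> k" for i j k
    using isotone[OF sub[OF that(1)] sub[OF that(2)]] by (simp_all add: M_def)
  have "\<exists>w. i \<le> j \<longrightarrow> w \<in> carrier R \<and> M i j = pr_ideal R w" for i j
    using M(1)[of i j] by (auto simp: pr_lattice_simps)
  then obtain w where w: "\<And>i j. i \<le> j \<Longrightarrow> w i j \<in> carrier R \<and> M i j = pr_ideal R (w i j)"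
    by metis
  have dis: "pr_ideal R (e i) \<inter> pr_ideal R (w i j) = {\<zero>}" if "i \<le> j" for i j
    using pr_direct_sum(1)[OF e M(1)[OF that] e M(2,3)[OF that]] w[OF that] by simp
  have "\<exists>a. i \<le> j \<longrightarrow> a \<in> pr_ideal R (e i) \<and> e j \<ominus> a \<in> M i j" for i j
    using pr_direct_sum(2)[OF e M(1) e M(2,3), of i j] by blast
  then obtain a where a: "\<And>i j. i \<le> j \<Longrightarrow> a i j \<in> pr_ideal R (e i) \<and> e j \<ominus> a i j \<in> M i j"
    by metis
  have ac: "a i j \<in> carrier R" if "i \<le> j" for i j
    using pr_ideal_closed[OF e] a[OF that] by blast
  \<comment> \<open>Isotonicity puts \<open>e j - a i j\<close> into \<open>M i k\<close>, so
    \<open>e j\<close> and \<open>e k\<close> are both projected along the same complement of the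
    ideal of \<open>e i\<close>.\<close>
  have restrict: "a i k \<otimes> e j = a i j" if "i \<le> j" "j \<le> k" for i j k
  proof -
    have ik: "i \<le> k"
      using that by simp
    show ?thesis
      using complement_projection_mult[OF e e e le[OF that(2)] _ dis[OF ik], of "a i j" "a i k"]
        w[OF ik] a[OF that(1)] a[OF ik] mono(1)[OF that] by auto
  qed
  show thesis
  proof (rule that[of a])
    fix i j :: 'i assume ij: "i \<le> j"
    show "a i j \<in> carrier R"
      by (rule ac[OF ij])
    show "e i \<otimes> a i j = a i j"
      using a[OF ij] pr_ideal_idem_mem[OF e[of i] le[of i i]] ac[OF ij] by simp
    \<comment> \<open>As zero lies in the complement, \<open>e i\<close> is its own component; the
      multiplication lemma then applies with \<open>f = e i\<close> and
      \<open>f' = e j\<close>.\<close>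
    have "\<zero> = w i j \<otimes> \<zero>"
      using w[OF ij] by simp
    then have "\<zero> \<in> pr_ideal R (w i j)"
      unfolding pr_ideal_def by blast
    then have "e i \<ominus> e i \<in> pr_ideal R (w i j)"
      using e by (simp add: minus_eq r_neg)
    then show "a i j \<otimes> e i = e i"
      using complement_projection_mult[OF e e e le[OF ij] _ dis[OF ij], of "e i" "a i j"]
        w[OF ij] a[OF ij] pr_ideal_mem[OF e] by auto
  next
    fix i j k :: 'i assume ij: "i \<le> j" and jk: "j \<le> k"
    then have ik: "i \<le> k"
      by simp
    show "a i k \<otimes> e j = a i j"
      by (rule restrict[OF ij jk])
    have c: "a i k \<in> carrier R" "a j k \<in> carrier R"
      using ac ik jk by auto
    have ej: "e j \<otimes> a j k = a j k"
      using a[OF jk] pr_ideal_idem_mem[OF e[of j] le[of j j]] ac[OF jk] by simp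
    have "e k \<otimes> a j k = e k \<otimes> e j \<otimes> a j k"
      using e c(2) ej by (simp add: m_assoc)
    \<comment> \<open>By antitonicity the remainder \<open>e k - a j k\<close> lies in
      \<open>M i k\<close>. It is also fixed by \<open>e k\<close>, hence annihilated by
      \<open>a i k\<close>.\<close>
    then have "e k \<otimes> (e k \<ominus> a j k) = e k \<ominus> a j k"
      using le[OF jk] le[of k k] ej e c(2) by (simp add: minus_eq r_distr r_minus)
    moreover have "e k \<ominus> a j k \<in> pr_ideal R (w i k)"
      using a[OF jk] mono(2)[OF ij jk] w[OF ik] by auto
    ultimately have "a i k \<otimes> (e k \<ominus> a j k) = \<zero>"
      using complement_projection_zero[OF e _ dis[OF ik] e] w[OF ik] a[OF ik] by auto
    then have "a i k \<otimes> e k \<ominus> a i k \<otimes> a j k = \<zero>"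
      using c e by (simp add: minus_eq r_distr r_minus)
    then have "a i k \<otimes> e k = a i k \<otimes> a j k"
      using c e eq_of_minus_zero[of "a i k \<otimes> e k" "a i k \<otimes> a j k"] by simp
    then show "a i k \<otimes> a j k = a i k"
      using restrict[OF ik, of k] by simp
  qed
qed

end

section \<open>Supports in the first uncountable ordinal\<close>

text \<open>Otherwise countably many countable initial segments would cover the uncountable
  chain.\<close>

lemma countable_omega1_bounded:
  assumes "countable (A :: omega1 set)"
  shows "\<exists>b. \<forall>a\<in>A. a < b"
proof (rule ccontr)
  assume "\<nexists>b. \<forall>a\<in>A. a < b"
  then have "UNIV = (\<Union>a\<in>A. insert a {..<a})"
    by (auto simp: not_less le_less)
  moreover have "countable (\<Union>a\<in>A. insert a {..<a})"
    using assms countable_omega1_less by (intro countable_UN) auto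
  ultimately show False
    using uncountable_omega1 by simp
qed

text \<open>Let \<open>h x\<close> exceed all \<open>y \<le> x\<close> and their values
  \<open>g y\<close>. The supremum of the iterates of \<open>h\<close> at \<alpha> is a limit, and
  \<open>g\<close> maps the ordinals below it below it.\<close>

lemma omega1_closure_point:
  fixes g :: "omega1 \<Rightarrow> omega1"
  shows "\<exists>\<theta>>\<alpha>. \<forall>\<delta><\<theta>. \<exists>\<delta>'<\<theta>. \<delta> < \<delta>' \<and> g \<delta> \<le> \<delta>'"
proof -
  have "\<exists>b. \<forall>y\<le>x. y < b \<and> g y < b" for x
  proof -
    have "countable {..x}"
      using countable_omega1_less[of x] by (simp add: ivl_disj_un_singleton(2)[symmetric])
    then show ?thesis
      using countable_omega1_bounded[of "{..x} \<union> g ` {..x}"] by auto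
  qed
  then obtain h where h: "\<And>x y. y \<le> x \<Longrightarrow> y < h x \<and> g y < h x"
    by metis
  define s where "s n = (h ^^ n) \<alpha>" for n
  have s: "y < s (Suc n) \<and> g y < s (Suc n)" if "y \<le> s n" for n y
    using h[OF that] by (simp add: s_def)
  \<comment> \<open>By minimality, every ordinal below \<theta> is at most some \<open>s n\<close>,
    and \<open>s (Suc n)\<close> then serves as \<delta>'.\<close>
  define \<theta> where "\<theta> = (LEAST b. \<forall>n. s n < b)"
  have \<theta>: "\<forall>n. s n < \<theta>"
    unfolding \<theta>_def by (rule LeastI_ex) (use countable_omega1_bounded[of "range s"] in auto)
  have "\<exists>\<delta>'<\<theta>. \<delta> < \<delta>' \<and> g \<delta> \<le> \<delta>'" if less: "\<delta> < \<theta>" for \<delta>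
  proof -
    obtain n where "\<delta> \<le> s n"
      using not_less_Least[of \<delta> "\<lambda>b. \<forall>n. s n < b"] less unfolding \<theta>_def
      by (meson not_less)
    then show ?thesis
      using s[of \<delta> n] \<theta> by (intro exI[of _ "s (Suc n)"]) auto
  qed
  moreover have "\<alpha> < \<theta>"
    using \<theta>[rule_format, of 0] by (simp add: s_def)
  ultimately show ?thesis
    by blast
qed

lemma finite_bound_below_limit:
  fixes \<theta> :: "'a::linorder"
  assumes "finite F" "\<alpha> < \<theta>" "\<And>\<delta>. \<delta> < \<theta> \<Longrightarrow> \<exists>\<delta>'<\<theta>. \<delta> < \<delta>'"
  shows "\<exists>\<delta><\<theta>. F \<inter> {\<delta>..<\<theta>} = {}"
proof -
  \<comment> \<open>Adjoining \<alpha> keeps the set nonempty, so that \<open>Max\<close> is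
    meaningful even if \<open>F\<close> has no element below \<theta>.\<close>
  define G where "G = insert \<alpha> (F \<inter> {..<\<theta>})"
  have G: "finite G" "Max G < \<theta>"
    using assms(1,2) by (auto simp: G_def)
  then obtain \<delta> where \<delta>: "\<delta> < \<theta>" "Max G < \<delta>"
    using assms(3) by blast
  then have "x < \<delta>" if "x \<in> F" "x < \<theta>" for x
    using Max_ge[OF G(1), of x] that by (auto simp: G_def)
  then show ?thesis
    using \<delta>(1) by (intro exI[of _ \<delta>]) (auto simp: not_less[symmetric])
qed

text \<open>A pressing-down statement: otherwise a closure point of the bounds would be the limit of a
  finite set.\<close>

lemma finite_sets_press_down:
  fixes S :: "omega1 \<Rightarrow> omega1 set"
  assumes fin: "\<And>\<theta>. finite (S \<theta>)"
  shows "\<exists>\<delta>. \<forall>\<gamma>. \<exists>\<theta>>\<gamma>. S \<theta> \<inter> {\<delta>..<\<theta>} = {}"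
proof (rule ccontr)
  assume "\<not> ?thesis"
  then obtain g where g: "\<And>\<delta> \<theta>. g \<delta> < \<theta> \<Longrightarrow> S \<theta> \<inter> {\<delta>..<\<theta>} \<noteq> {}"
    by metis
  \<comment> \<open>The starting point \<open>undefined\<close> is an arbitrary ordinal; what
    matters is that \<theta> is a limit closed under \<open>g\<close>.\<close>
  obtain \<theta> where \<theta>: "undefined < \<theta>" "\<And>\<delta>. \<delta> < \<theta> \<Longrightarrow> \<exists>\<delta>'<\<theta>. \<delta> < \<delta>' \<and> g \<delta> \<le> \<delta>'"
    using omega1_closure_point[of undefined g] by blast
  obtain \<delta> where \<delta>: "\<delta> < \<theta>" "S \<theta> \<inter> {\<delta>..<\<theta>} = {}"
    using finite_bound_below_limit[OF fin \<theta>(1)] \<theta>(2) by blast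
  then show False
    using g[of \<delta> \<theta>] \<theta>(2)[OF \<delta>(1)] le_less_trans by blast
qed

text \<open>The order of choice is \<eta>, \<zeta>, \<xi>, \<theta>. Closure of \<eta> under
  \<open>d\<close> allows \<xi> to be taken late, above the part of \<open>S \<eta> \<zeta>\<close>
  below \<eta>, while \<open>d \<xi>\<close> still stays below \<eta>.\<close>

lemma separated_supports:
  fixes S :: "omega1 \<Rightarrow> omega1 \<Rightarrow> omega1 set"
  assumes fin: "\<And>\<xi> \<theta>. finite (S \<xi> \<theta>)"
  obtains \<xi> \<eta> \<zeta> \<theta> where "\<xi> < \<eta>" "\<eta> < \<zeta>" "\<zeta> < \<theta>"
    "S \<xi> \<theta> \<inter> {\<eta>..<\<theta>} = {}" "S \<eta> \<zeta> \<inter> {\<xi>..<\<eta>} = {}"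
proof -
  have "\<exists>\<delta>. \<forall>\<gamma>. \<exists>\<theta>>\<gamma>. S \<xi> \<theta> \<inter> {\<delta>..<\<theta>} = {}" for \<xi>
    by (rule finite_sets_press_down) (rule fin)
  then obtain d where d: "\<And>\<xi> \<gamma>. \<exists>\<theta>>\<gamma>. S \<xi> \<theta> \<inter> {d \<xi>..<\<theta>} = {}"
    by metis
  obtain \<eta> where \<eta>: "undefined < \<eta>" "\<And>\<delta>. \<delta> < \<eta> \<Longrightarrow> \<exists>\<delta>'<\<eta>. \<delta> < \<delta>' \<and> d \<delta> \<le> \<delta>'"
    using omega1_closure_point[of undefined d] by blast
  \<comment> \<open>Here \<open>d\<close> serves only to supply some ordinal above \<eta>.\<close>
  obtain \<zeta> where \<zeta>: "\<eta> < \<zeta>"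
    using d by blast
  obtain \<xi> where \<xi>: "\<xi> < \<eta>" "S \<eta> \<zeta> \<inter> {\<xi>..<\<eta>} = {}"
    using finite_bound_below_limit[OF fin \<eta>(1)] \<eta>(2) by blast
  obtain \<theta> where \<theta>: "\<zeta> < \<theta>" "S \<xi> \<theta> \<inter> {d \<xi>..<\<theta>} = {}"
    using d by blast
  have "d \<xi> < \<eta>"
    using \<eta>(2)[OF \<xi>(1)] by auto
  then have "S \<xi> \<theta> \<inter> {\<eta>..<\<theta>} = {}"
    using \<theta>(2) by fastforce
  with \<xi> \<zeta> \<theta> show thesis
    by (intro that)
qed

section \<open>Matrix subalgebras\<close>

lemma matrix_diff_ldistrib: "A ** (B - C) = A ** B - A ** (C :: 'f::field^3^3)"
  by (simp add: matrix_matrix_mult_def vec_eq_iff right_diff_distrib sum_subtractf)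

lemma matrix_diff_rdistrib: "(B - C) ** A = B ** A - C ** (A :: 'f::field^3^3)"
  by (simp add: matrix_matrix_mult_def vec_eq_iff left_diff_distrib sum_subtractf)

lemma mscale_mult: "mscale c X ** Y = mscale c (X ** Y)" "X ** mscale c Y = mscale c (X ** Y)"
  by (simp_all add: mscale_def map_matrix_def matrix_matrix_mult_def vec_eq_iff sum_distrib_left
      mult_ac)

lemma gen_subalg_commute: "X \<in> gen_subalg M \<Longrightarrow> X ** M = M ** X"
proof (induction rule: gen_subalg.induct)
  case (4 X Y)
  then show ?case
    by (metis matrix_mul_assoc)
qed (simp_all add: matrix_diff_ldistrib matrix_diff_rdistrib mscale_mult)

lemma zero_in_gen_subalg: "0 \<in> gen_subalg M"
  using gen_subalg.intros(3)[OF gen_subalg.intros(1) gen_subalg.intros(1)] by simp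

text \<open>Elements of the subalgebra commute with \<open>M\<close>, so
  \<open>X = MX = XM = M\<close>: inside it, the projection onto the range of \<open>M\<close> is
  forced.\<close>

lemma idem_gen_unique:
  assumes "X \<in> gen_subalg M" "M ** X = X" "X ** M = M"
  shows "X = M"
  using gen_subalg_commute[OF assms(1)] assms(2,3) by simp

text \<open>For the inequality: left multiplication by \<open>matA\<close> keeps only the first row,
  and that of \<open>matB\<close> is (1, 0, 1).\<close>

lemma matA_matB_mult:
  "matA ** matA = (matA :: 'f::field^3^3)" "matB ** matB = (matB :: 'f^3^3)"
  "matB ** matA = (matA :: 'f^3^3)" "matA ** matB \<noteq> (matA :: 'f^3^3)"
  by (simp_all add: matA_def matB_def matrix_matrix_mult_def vec_eq_iff forall_3 sum_3 vector_3)

text \<open>Any member of the family containing \<open>X\<close> includes the smallest such member,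
  where \<open>q X\<close> lies.\<close>

lemma qinv_gen_subalg:
  assumes "admissible_qinv q" "gen_subalg M \<in> subalg_family" "X \<in> gen_subalg M"
  shows "q X \<in> gen_subalg M"
  using assms unfolding admissible_qinv_def by blast

lemma eval_gen_subalg:
  assumes "admissible_qinv q" "gen_subalg M \<in> subalg_family"
    and "\<And>v. v \<in> set2_trm t \<Longrightarrow> \<rho> v \<in> gen_subalg M"
  shows "eval (R_alg q) \<rho> t \<in> gen_subalg M"
  using assms(3)
proof (induction t)
  case (QInv t)
  then show ?case
    using qinv_gen_subalg[OF assms(1,2)] by (simp add: R_alg_def)
qed (auto simp: R_alg_def zero_in_gen_subalg intro: gen_subalg.intros)

section \<open>The non-existence theorem\<close>

lemma regular_ring_of_variety:
  fixes S :: "('a, 'f::field) sig_struct"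
  assumes "qi_variety E" "satisfies S E"
  shows "regular_ring (ring_of S)"
proof -
  have S: "in_Reg S"
    by (rule qi_variety_in_Reg[OF assms])
  then interpret ring "ring_of S"
    by (simp add: in_Reg_def)
  show ?thesis
    using S by unfold_locales (auto simp: in_Reg_def ring_of_def sig_closed_def)
qed

text \<open>Representing the projections by terms gives them finite supports, and their equations
  become congruences that can be evaluated in any member of the variety.\<close>

lemma chain_measure_terms:
  fixes E :: "'f::field identity set"
  assumes E: "qi_variety E"
    and m: "banaschewski_measure
      (pr_lattice (chain_alg E :: (('f, 'v::linorder) trm set, 'f) sig_struct))
      {pr_ideal (chain_alg E) (chain_gen E \<xi>) | \<xi> :: 'v::linorder. True} m"
  obtains t :: "'v::linorder \<Rightarrow> 'v \<Rightarrow> ('f, 'v) trm" where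
    "\<And>i j. i \<le> j \<Longrightarrow> pres_eq E chain_rels (Mult (Var i) (t i j)) (t i j)"
    "\<And>i j. i \<le> j \<Longrightarrow> pres_eq E chain_rels (Mult (t i j) (Var i)) (Var i)"
    "\<And>i j k. i \<le> j \<Longrightarrow> j \<le> k \<Longrightarrow> pres_eq E chain_rels (Mult (t i k) (Var j)) (t i j)"
    "\<And>i j k. i \<le> j \<Longrightarrow> j \<le> k \<Longrightarrow> pres_eq E chain_rels (Mult (t i k) (t j k)) (t i k)"
proof -
  define S where "S = (chain_alg E :: (('f, 'v) trm set, 'f) sig_struct)"
  define p where "p = pres_class E (chain_rels :: ('f, 'v) trm rel)"
  have S: "satisfies S E"
    unfolding S_def chain_alg_def by (rule satisfies_presented)
  interpret R: regular_ring "ring_of S"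
    by (rule regular_ring_of_variety[OF E S])
  have car: "carrier (ring_of S) = range p"
    by (simp add: ring_of_def S_def p_def chain_alg_def presented_ops)
  have mul: "p s \<otimes>\<^bsub>ring_of S\<^esub> p t = p (Mult s t)" for s t
    by (simp add: ring_of_def S_def p_def chain_alg_def presented_ops)
  have eq: "p s = p t \<longleftrightarrow> pres_eq E chain_rels s t" for s t
    by (simp add: p_def pres_class_eq_iff)
  have pi: "pr_ideal S = pr_ideal (ring_of S)"
    by (simp add: pr_ideal_def ring_of_def fun_eq_iff)
  have pl: "pr_lattice S = pr_lattice (ring_of S)"
    by (simp add: pr_lattice_def pi) (simp add: ring_of_def)
  have m': "banaschewski_measure (pr_lattice (ring_of S)) {pr_ideal (ring_of S) (p (Var i)) | i. True} m"
    using m unfolding S_def[symmetric] pi pl chain_gen_def p_def[symmetric] .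
  have c: "p (Var i) \<in> carrier (ring_of S)" for i
    by (simp add: car)
  have le: "p (Var j) \<otimes>\<^bsub>ring_of S\<^esub> p (Var i) = p (Var i)" if "i \<le> j" for i j
    unfolding mul eq using that
    by (intro pres_eq.sym[OF pres_eq.rel]) (auto simp: chain_rels_def)
  obtain a where a: "\<And>i j. i \<le> j \<Longrightarrow> a i j \<in> carrier (ring_of S)"
      "\<And>i j. i \<le> j \<Longrightarrow> p (Var i) \<otimes>\<^bsub>ring_of S\<^esub> a i j = a i j"
      "\<And>i j. i \<le> j \<Longrightarrow> a i j \<otimes>\<^bsub>ring_of S\<^esub> p (Var i) = p (Var i)"
      "\<And>i j k. i \<le> j \<Longrightarrow> j \<le> k \<Longrightarrow> a i k \<otimes>\<^bsub>ring_of S\<^esub> p (Var j) = a i j"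
      "\<And>i j k. i \<le> j \<Longrightarrow> j \<le> k \<Longrightarrow> a i k \<otimes>\<^bsub>ring_of S\<^esub> a j k = a i k"
    by (rule R.banaschewski_projections[OF c le m']) (assumption, rule that)
  have "\<exists>t. i \<le> j \<longrightarrow> a i j = p t" for i j
    using a(1)[of i j] by (auto simp: car)
  then obtain t where t: "\<And>i j. i \<le> j \<Longrightarrow> a i j = p (t i j)"
    by metis
  show thesis
  proof (rule that[of t])
    fix i j :: 'v assume "i \<le> j"
    then show "pres_eq E chain_rels (Mult (Var i) (t i j)) (t i j)"
        "pres_eq E chain_rels (Mult (t i j) (Var i)) (Var i)"
      using a(2,3)[of i j] t[of i j] by (simp_all add: mul eq)
  next
    fix i j k :: 'v assume "i \<le> j" "j \<le> k"
    then show "pres_eq E chain_rels (Mult (t i k) (Var j)) (t i j)"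
        "pres_eq E chain_rels (Mult (t i k) (t j k)) (t i k)"
      using a(4,5)[of i j k] t[of i j] t[of i k] t[of j k] by (simp_all add: mul eq)
  qed
qed

theorem theorem6p4:
  fixes E :: "'f::field identity set" and q :: "'f^3^3 \<Rightarrow> 'f^3^3"
  assumes "countable (UNIV :: 'f set)"
    and "admissible_qinv q"
    and "qi_variety E"
    and "satisfies (R_alg q) E"
  shows "\<nexists>m. banaschewski_measure
    (pr_lattice (chain_alg E :: (('f, omega1) trm set, 'f) sig_struct))
    {pr_ideal (chain_alg E) (chain_gen E \<xi>) | \<xi> :: omega1. True} m"
proof
  assume "\<exists>m. banaschewski_measure
    (pr_lattice (chain_alg E :: (('f, omega1) trm set, 'f) sig_struct))
    {pr_ideal (chain_alg E) (chain_gen E \<xi>) | \<xi> :: omega1. True} m"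
  then obtain m where m: "banaschewski_measure
    (pr_lattice (chain_alg E :: (('f, omega1) trm set, 'f) sig_struct))
    {pr_ideal (chain_alg E) (chain_gen E \<xi>) | \<xi> :: omega1. True} m"
    by blast
  obtain t :: "omega1 \<Rightarrow> omega1 \<Rightarrow> ('f, omega1) trm" where t:
    "\<And>i j. i \<le> j \<Longrightarrow> pres_eq E chain_rels (Mult (Var i) (t i j)) (t i j)"
    "\<And>i j. i \<le> j \<Longrightarrow> pres_eq E chain_rels (Mult (t i j) (Var i)) (Var i)"
    "\<And>i j k. i \<le> j \<Longrightarrow> j \<le> k \<Longrightarrow> pres_eq E chain_rels (Mult (t i k) (Var j)) (t i j)"
    "\<And>i j k. i \<le> j \<Longrightarrow> j \<le> k \<Longrightarrow> pres_eq E chain_rels (Mult (t i k) (t j k)) (t i k)"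
    by (rule chain_measure_terms[OF assms(3) m]) (rule that)
  have fin: "finite (set2_trm s)" for s :: "('f, omega1) trm"
    by (induction s) auto
  obtain \<xi> \<eta> \<zeta> \<theta> where o: "\<xi> < \<eta>" "\<eta> < \<zeta>" "\<zeta> < \<theta>"
      and supp: "set2_trm (t \<xi> \<theta>) \<inter> {\<eta>..<\<theta>} = {}" "set2_trm (t \<eta> \<zeta>) \<inter> {\<xi>..<\<eta>} = {}"
    by (rule separated_supports[of "\<lambda>i j. set2_trm (t i j)", OF fin]) (rule that)
  \<comment> \<open>The values 0, \<open>matA\<close>, \<open>matB\<close>, 1 form an increasing
    chain of idempotents, so the assignment respects \<open>chain_rels\<close>.\<close>
  define \<rho> :: "omega1 \<Rightarrow> 'f^3^3" where
    "\<rho> v = (if v < \<xi> then 0 else if v < \<eta> then matA else if v = \<eta> then matB else mat 1)" for v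
  have \<rho>: "\<rho> \<xi> = matA" "\<rho> \<eta> = matB" "\<rho> \<zeta> = mat 1"
    using o by (auto simp: \<rho>_def)
  have mono: "\<rho> \<beta> ** \<rho> \<alpha> = \<rho> \<alpha>" if "\<alpha> \<le> \<beta>" for \<alpha> \<beta>
    using that o by (auto simp: \<rho>_def matA_matB_mult)
  let ?ev = "eval (R_alg q) \<rho>"
  have sound: "?ev s = ?ev u" if "pres_eq E chain_rels s u" for s u
    by (rule pres_eq_sound[OF assms(4) _ _ that])
      (use mono in \<open>auto simp: R_alg_def chain_rels_def\<close>)
  have mul: "mult (R_alg q) X Y = X ** Y" for X Y
    by (simp add: R_alg_def)
  have le: "\<xi> \<le> \<eta>" "\<eta> \<le> \<zeta>" "\<xi> \<le> \<zeta>" "\<zeta> \<le> \<theta>"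
    using o by auto
  have fam: "gen_subalg matA \<in> subalg_family" "gen_subalg matB \<in> subalg_family"
    by (simp_all add: subalg_family_def)
  define C where "C = ?ev (t \<xi> \<zeta>)"
  define D where "D = ?ev (t \<eta> \<zeta>)"
  \<comment> \<open>As \<rho> sends \<zeta> to 1, multiplying by its generator changes nothing. This
    passes from \<zeta>, chosen before \<xi>, to \<theta>, whose support is controlled.\<close>
  have "C = ?ev (t \<xi> \<theta>)"
    using sound[OF t(3)[OF le(3,4)]] \<rho>(3) by (simp add: mul C_def)
  moreover have "?ev (t \<xi> \<theta>) \<in> gen_subalg matA"
  proof (rule eval_gen_subalg[OF assms(2) fam(1)])
    fix v assume "v \<in> set2_trm (t \<xi> \<theta>)"
    \<comment> \<open>The remaining variables take the values 0, \<open>matA\<close> or 1; the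
      avoided interval contains \<eta>, the only one sent to \<open>matB\<close>.\<close>
    then have "v < \<eta> \<or> \<theta> \<le> v"
      using supp(1) by force
    then show "\<rho> v \<in> gen_subalg matA"
      using o by (auto simp: \<rho>_def zero_in_gen_subalg intro: gen_subalg.intros)
  qed
  ultimately have "C \<in> gen_subalg matA"
    by simp
  moreover have "matA ** C = C" "C ** matA = matA"
    using sound[OF t(1)[OF le(3)]] sound[OF t(2)[OF le(3)]] \<rho>(1)
    by (simp_all add: mul C_def)
  ultimately have C: "C = matA"
    by (rule idem_gen_unique)
  have "D \<in> gen_subalg matB"
    unfolding D_def
  proof (rule eval_gen_subalg[OF assms(2) fam(2)])
    fix v assume "v \<in> set2_trm (t \<eta> \<zeta>)"
    \<comment> \<open>The avoided interval consists of exactly the variables sent to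
      \<open>matA\<close>.\<close>
    then have "v < \<xi> \<or> \<eta> \<le> v"
      using supp(2) by force
    then show "\<rho> v \<in> gen_subalg matB"
      using o by (auto simp: \<rho>_def zero_in_gen_subalg intro: gen_subalg.intros)
  qed
  moreover have "matB ** D = D" "D ** matB = matB"
    using sound[OF t(1)[OF le(2)]] sound[OF t(2)[OF le(2)]] \<rho>(2)
    by (simp_all add: mul D_def)
  ultimately have "D = matB"
    by (rule idem_gen_unique)
  moreover have "C ** D = C"
    using sound[OF t(4)[OF le(1,2)]] by (simp add: mul C_def D_def)
  ultimately show False
    using C by (simp add: matA_matB_mult)
qed

end
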